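(* For all multi-valued functions $f$ and $g$ on represented spaces, $$f\leq_{\mathrm W}g\iff\mathrm{id}\times f\leq_{\mathrm{sW}}\mathrm{id}\times g,$$ where $\mathrm{id}:\mathbb{N}^{\mathbb{N}}\to\mathbb{N}^{\mathbb{N}}$ is the identity on Baire space.
   Context: A represented space $(X,\delta_X)$ is a set $X$ with a surjective partial map $\delta_X:\subseteq\mathbb{N}^{\mathbb{N}}\to X$; $\mathbb{N}^{\mathbb{N}}$ is represented by the identity. A multi-valued function $f:\subseteq X\rightrightarrows Y$ assigns to each $x$ a set $f(x)\subseteq Y$, with $\mathrm{dom}(f)=\{x: f(x)\neq\emptyset\}$. A realizer of $f$ is a partial $F:\subseteq\mathbb{N}^{\mathbb{N}}\to\mathbb{N}^{\mathbb{N}}$ such that $F(p)$ is defined and $\delta_YF(p)\in f(\delta_X(p))$ whenever $\delta_X(p)\in\mathrm{dom}(f)$. $f\leq_{\mathrm W}g$ iff there are computable $H,K:\subseteq\mathbb{N}^{\mathbb{N}}\to\mathbb{N}^{\mathbb{N}}$ such that for every realizer $G$ of $g$ the function $p\mapsto H\langle p,GK(p)\rangle$ is a realizer of $f$, where $\langle\cdot,\cdot\rangle$ is a computable pairing on $\mathbb{N}^{\mathbb{N}}$. $f\leq_{\mathrm{sW}}g$ is defined in the same way with $H\circ G\circ K$ in place of $p\mapsto H\langle p,GK(p)\rangle$. Product: for $f:\subseteq X\rightrightarrows Y$, $g:\subseteq U\rightrightarrows V$, $(f\times g)(x,u)=f(x)\times g(u)$ on $\mathrm{dom}(f)\times\mathrm{dom}(g)$;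 products carry the representation $[\delta_X,\delta_U]\langle p,q\rangle=(\delta_X(p),\delta_U(q))$. *)

theory Defs
  imports Main
begin

section \<open>Computable partial functions on Baire space\<close>

type_synonym baire = "nat \<Rightarrow> nat"

text \<open>
  Programs for partial recursive functions relative to an oracle \<open>p\<close>. There is no
  arity discipline: a program applied to an argument list of unsuitable length is just
  undefined. In \<open>PrimRec f g\<close> and \<open>Mu f\<close> the recursion or search variable is the
  first argument.
\<close>

datatype prog =
    Zero
  | Succ
  | Proj nat
  | Query
  | Comp prog "prog list"
  | PrimRec prog prog
  | Mu prog

inductive eval :: "baire \<Rightarrow> prog \<Rightarrow> nat list \<Rightarrow> nat \<Rightarrow> bool" for p :: baire where
  Zero: "eval p Zero xs 0"
| Succ: "eval p Succ [x] (Suc x)"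
| Proj: "i < length xs \<Longrightarrow> eval p (Proj i) xs (xs ! i)"
| Query: "eval p Query [x] (p x)"
| Comp: "list_all2 (\<lambda>g y. eval p g xs y) gs ys \<Longrightarrow> eval p f ys z \<Longrightarrow> eval p (Comp f gs) xs z"
| PrimRec_0: "eval p f xs y \<Longrightarrow> eval p (PrimRec f g) (0 # xs) y"
| PrimRec_Suc: "eval p (PrimRec f g) (n # xs) y \<Longrightarrow> eval p g (n # y # xs) z
    \<Longrightarrow> eval p (PrimRec f g) (Suc n # xs) z"
| Mu: "eval p f (n # xs) 0 \<Longrightarrow> (\<forall>m<n. \<exists>y. eval p f (m # xs) (Suc y)) \<Longrightarrow> eval p (Mu f) xs n"

inductive_cases eval_ZeroE: "eval p Zero xs z"
inductive_cases eval_SuccE: "eval p Succ xs z"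
inductive_cases eval_ProjE: "eval p (Proj i) xs z"
inductive_cases eval_QueryE: "eval p Query xs z"
inductive_cases eval_CompE: "eval p (Comp f gs) xs z"
inductive_cases eval_PrimRec_0E: "eval p (PrimRec f g) (0 # xs) z"
inductive_cases eval_PrimRec_SucE: "eval p (PrimRec f g) (Suc n # xs) z"
inductive_cases eval_MuE: "eval p (Mu f) xs z"

lemma eval_deterministic:
  assumes "eval p f xs y" and "eval p f xs z"
  shows "y = z"
  using assms
proof (induction arbitrary: z rule: eval.induct)
  case (Zero xs)
  then show ?case by (rule eval_ZeroE) simp
next
  case (Succ x)
  then show ?case by (rule eval_SuccE) simp
next
  case (Proj i xs)
  from Proj.prems show ?case by (rule eval_ProjE) simp
next
  case (Query x)
  then show ?case by (rule eval_QueryE) simp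
next
  case (Comp xs gs ys f w)
  from Comp.prems obtain ys' where
    ys': "list_all2 (\<lambda>g y. eval p g xs y) gs ys'" "eval p f ys' z"
    by (rule eval_CompE)
  have "ys = ys'"
  proof (rule nth_equalityI)
    show "length ys = length ys'"
      using Comp.IH(1) ys'(1) by (simp add: list_all2_conv_all_nth)
    show "ys ! i = ys' ! i" if "i < length ys" for i
      using Comp.IH(1) ys'(1) that by (simp add: list_all2_conv_all_nth)
  qed
  then show ?case using Comp.IH(2) ys'(2) by blast
next
  case (PrimRec_0 f xs y g)
  from PrimRec_0.prems have "eval p f xs z" by (rule eval_PrimRec_0E)
  then show ?case by (rule PrimRec_0.IH)
next
  case (PrimRec_Suc f g n xs y w)
  from PrimRec_Suc.prems obtain y' where
    "eval p (PrimRec f g) (n # xs) y'" "eval p g (n # y' # xs) z"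
    by (rule eval_PrimRec_SucE)
  then show ?case using PrimRec_Suc.IH by blast
next
  case (Mu f n xs)
  from Mu.prems have z: "eval p f (z # xs) 0" "\<forall>m<z. \<exists>y. eval p f (m # xs) (Suc y)"
    by (auto intro: eval_MuE[OF Mu.prems])
  show ?case
  proof (rule linorder_cases[of n z])
    assume "n < z"
    then obtain y where "eval p f (n # xs) (Suc y)" using z(2) by blast
    then show ?thesis using Mu.IH(1) by blast
  next
    assume "z < n"
    then show ?thesis using Mu.IH(2) z(1) by blast
  qed
qed

text \<open>
  A single program must compute the digits of \<open>F p\<close> from the oracle \<open>p\<close>, uniformly for
  all \<open>p\<close> in the domain. As usual, nothing is required outside the domain.
\<close>

definition computable :: "(baire \<rightharpoonup> baire) \<Rightarrow> bool" where
  "computable F \<longleftrightarrow> (\<exists>e. \<forall>p q. F p = Some q \<longrightarrow> (\<forall>n. eval p e [n] (q n)))"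

definition pair :: "baire \<Rightarrow> baire \<Rightarrow> baire" where
  "pair p q = (\<lambda>n. if even n then p (n div 2) else q (n div 2))"

definition pfst :: "baire \<Rightarrow> baire" where
  "pfst r = (\<lambda>n. r (2 * n))"

definition psnd :: "baire \<Rightarrow> baire" where
  "psnd r = (\<lambda>n. r (2 * n + 1))"

lemma pfst_pair [simp]: "pfst (pair p q) = p"
  by (simp add: pfst_def pair_def)

lemma psnd_pair [simp]: "psnd (pair p q) = q"
  by (simp add: psnd_def pair_def)

lemma pair_pfst_psnd [simp]: "pair (pfst r) (psnd r) = r"
  by (auto simp: pfst_def psnd_def pair_def fun_eq_iff)


section \<open>Represented spaces and multi-valued functions\<close>

record 'a rep_space =
  points :: "'a set"
  rep :: "baire \<rightharpoonup> 'a"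

definition represented_space :: "'a rep_space \<Rightarrow> bool" where
  "represented_space X \<longleftrightarrow> ran (rep X) = points X"

definition baire_space :: "baire rep_space" where
  "baire_space = \<lparr>points = UNIV, rep = Some\<rparr>"

definition prod_space :: "'a rep_space \<Rightarrow> 'b rep_space \<Rightarrow> ('a \<times> 'b) rep_space" where
  "prod_space X U = \<lparr>points = points X \<times> points U,
     rep = (\<lambda>r. case (rep X (pfst r), rep U (psnd r)) of
                   (Some x, Some u) \<Rightarrow> Some (x, u)
                 | _ \<Rightarrow> None)\<rparr>"

lemma rep_prod_space_pair:
  "rep (prod_space X U) (pair p q) = Some (x, u) \<longleftrightarrow> rep X p = Some x \<and> rep U q = Some u"
  by (auto simp: prod_space_def split: option.splits)

record ('a, 'b) multifun =
  src :: "'a rep_space"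
  tgt :: "'b rep_space"
  vals :: "'a \<Rightarrow> 'b set"

definition mdom :: "('a, 'b) multifun \<Rightarrow> 'a set" where
  "mdom f = {x. vals f x \<noteq> {}}"

definition multivalued :: "('a, 'b) multifun \<Rightarrow> bool" where
  "multivalued f \<longleftrightarrow> represented_space (src f) \<and> represented_space (tgt f)
     \<and> mdom f \<subseteq> points (src f) \<and> (\<forall>x. vals f x \<subseteq> points (tgt f))"

definition mid :: "(baire, baire) multifun" where
  "mid = \<lparr>src = baire_space, tgt = baire_space, vals = (\<lambda>p. {p})\<rparr>"

definition mprod ::
    "('a, 'b) multifun \<Rightarrow> ('c, 'd) multifun \<Rightarrow> ('a \<times> 'c, 'b \<times> 'd) multifun"
    (infixr "\<times>\<^sub>m" 80) where
  "f \<times>\<^sub>m g = \<lparr>src = prod_space (src f) (src g), tgt = prod_space (tgt f) (tgt g),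
     vals = (\<lambda>(x, u). vals f x \<times> vals g u)\<rparr>"

lemma mdom_mprod: "mdom (f \<times>\<^sub>m g) = mdom f \<times> mdom g"
  by (auto simp: mdom_def mprod_def)


section \<open>Weihrauch reducibility\<close>

definition realizer :: "(baire \<rightharpoonup> baire) \<Rightarrow> ('a, 'b) multifun \<Rightarrow> bool" where
  "realizer F f \<longleftrightarrow> (\<forall>p x. rep (src f) p = Some x \<and> x \<in> mdom f \<longrightarrow>
     (\<exists>q y. F p = Some q \<and> rep (tgt f) q = Some y \<and> y \<in> vals f x))"

definition weihrauch_le :: "('a, 'b) multifun \<Rightarrow> ('c, 'd) multifun \<Rightarrow> bool"
    (infix "\<le>\<^sub>W" 50) where
  "f \<le>\<^sub>W g \<longleftrightarrow> (\<exists>H K. computable H \<and> computable K \<and>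
     (\<forall>G. realizer G g \<longrightarrow>
        realizer (\<lambda>p. case (G \<circ>\<^sub>m K) p of None \<Rightarrow> None | Some q \<Rightarrow> H (pair p q)) f))"

definition strong_weihrauch_le :: "('a, 'b) multifun \<Rightarrow> ('c, 'd) multifun \<Rightarrow> bool"
    (infix "\<le>\<^sub>s\<^sub>W" 50) where
  "f \<le>\<^sub>s\<^sub>W g \<longleftrightarrow> (\<exists>H K. computable H \<and> computable K \<and>
     (\<forall>G. realizer G g \<longrightarrow> realizer (H \<circ>\<^sub>m G \<circ>\<^sub>m K) f))"

end

theory Submission imports Defs begin

text \<open>
  The factor \<open>id\<close> is a channel that carries the input past an oracle call. A strong
  reduction loses the input once \<open>K\<close> has been applied; but a realizer of
  \<open>id \<times> g\<close> has no freedom in its first component, as the identity represents Baire space.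
  So whatever \<open>K\<close> writes there comes back unchanged (\<open>realizer_mid_mprod_iff\<close>).

  From left to right, \<open>K\<close> sends \<open>\<langle>s, p\<rangle>\<close> to \<open>\<langle>\<langle>s, p\<rangle>, K p\<rangle>\<close>. The oracle answers
  \<open>\<langle>\<langle>s, p\<rangle>, q\<rangle>\<close>, from which \<open>\<langle>s, H \<langle>p, q\<rangle>\<rangle>\<close> is computed. The one subtle point is that
  the first component is returned intact only if \<open>K p\<close> names a point of the domain of \<open>g\<close>.
  This holds since the given reduction must work with every realizer of \<open>g\<close>, and hence with
  those that are undefined elsewhere (\<open>realizer_section\<close>).

  From right to left, \<open>f\<close> is fed into the reduction as \<open>\<langle>p, p\<rangle>\<close>. If \<open>K \<langle>p, p\<rangle> = \<langle>a, t\<rangle>\<close>,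
  then \<open>g\<close> is asked at \<open>t\<close>, and the component \<open>a\<close> that \<open>H\<close> expects is recomputed
  afterwards, because an ordinary reduction still has \<open>p\<close> at hand.

  What remains is that the functions used above are computable. They are built
  by composition and pairing from projections, \<open>H\<close> and \<open>K\<close>. Composition amounts to
  replacing oracle queries by calls of a program (\<open>eval_subst_query\<close>).
\<close>

section \<open>Closure properties of computable functions\<close>

subsection \<open>Composition\<close>

primrec subst_query :: "prog \<Rightarrow> prog \<Rightarrow> prog" where
  "subst_query e Zero = Zero"
| "subst_query e Succ = Succ"
| "subst_query e (Proj i) = Proj i"
| "subst_query e Query = e"
| "subst_query e (Comp f gs) = Comp (subst_query e f) (map (subst_query e) gs)"
| "subst_query e (PrimRec f g) = PrimRec (subst_query e f) (subst_query e g)"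
| "subst_query e (Mu f) = Mu (subst_query e f)"

text \<open>
  Only this direction holds: \<open>e\<close> may be defined on argument lists of a length other than 1,
  where \<open>Query\<close> is not. It suffices, as computability says nothing about divergence.
\<close>

lemma eval_subst_query:
  assumes "eval q c xs y" and "\<And>n. eval p e [n] (q n)"
  shows "eval p (subst_query e c) xs y"
  using assms(1)
proof (induction rule: eval.induct)
  case (Comp xs gs ys f z)
  then show ?case
    by (auto intro!: eval.Comp simp: list_all2_conv_all_nth)
next
  case (Mu f n xs)
  then show ?case
    by (auto intro!: eval.Mu)
qed (auto intro: eval.intros assms(2))

lemma computable_map_comp:
  assumes "computable F" and "computable G"
  shows "computable (F \<circ>\<^sub>m G)"
proof -
  obtain c where c: "\<And>q r n. F q = Some r \<Longrightarrow> eval q c [n] (r n)"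
    using assms(1) unfolding computable_def by blast
  obtain e where e: "\<And>p q n. G p = Some q \<Longrightarrow> eval p e [n] (q n)"
    using assms(2) unfolding computable_def by blast
  have "eval p (subst_query e c) [n] (r n)" if "(F \<circ>\<^sub>m G) p = Some r" for p r n
  proof -
    obtain q where "G p = Some q" "F q = Some r"
      using \<open>(F \<circ>\<^sub>m G) p = Some r\<close> unfolding map_comp_Some_iff by blast
    then show ?thesis
      by (blast intro: eval_subst_query c e)
  qed
  then show ?thesis
    unfolding computable_def by blast
qed

subsection \<open>Projections and pairing\<close>

lemma eval_Comp1:
  "eval p g xs y \<Longrightarrow> eval p f [y] z \<Longrightarrow> eval p (Comp f [g]) xs z"
  by (rule eval.Comp[where ys = "[y]"]) simp_all

lemma eval_Comp3:
  "eval p g1 xs y1 \<Longrightarrow> eval p g2 xs y2 \<Longrightarrow> eval p g3 xs y3 \<Longrightarrow> eval p f [y1, y2, y3] z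
    \<Longrightarrow> eval p (Comp f [g1, g2, g3]) xs z"
  by (rule eval.Comp[where ys = "[y1, y2, y3]"]) simp_all

lemma eval_Proj_eq: "i < length xs \<Longrightarrow> y = xs ! i \<Longrightarrow> eval p (Proj i) xs y"
  by (simp add: eval.Proj)

definition double_prog :: prog where
  "double_prog = PrimRec Zero (Comp Succ [Comp Succ [Proj 1]])"

lemma eval_double_prog: "eval p double_prog [n] (2 * n)"
  unfolding double_prog_def
proof (induction n)
  case 0
  show ?case by (auto intro: eval.intros)
next
  case (Suc n)
  show ?case
    by (rule eval.PrimRec_Suc[OF Suc]) (auto intro!: eval_Comp1 eval_Proj_eq eval.Succ)
qed

definition if_zero_prog :: prog where
  "if_zero_prog = PrimRec (Proj 0) (Proj 3)"

lemma eval_if_zero_prog: "eval p if_zero_prog [n, a, b] (if n = 0 then a else b)"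
  unfolding if_zero_prog_def
proof (induction n)
  case 0
  show ?case by (auto intro!: eval.PrimRec_0 eval_Proj_eq)
next
  case (Suc n)
  show ?case
    by (rule eval.PrimRec_Suc[OF Suc]) (auto intro!: eval_Proj_eq)
qed

definition parity_prog :: prog where
  "parity_prog =
     PrimRec Zero (Comp if_zero_prog [Proj 1, Comp Succ [Zero], Zero])"

lemma eval_parity_prog: "eval p parity_prog [n] (n mod 2)"
  unfolding parity_prog_def
proof (induction n)
  case 0
  show ?case by (auto intro: eval.intros)
next
  case (Suc n)
  have flip: "(if n mod 2 = 0 then Suc 0 else 0) = Suc n mod 2"
    by presburger
  show ?case
    by (rule eval.PrimRec_Suc[OF Suc],
        rule eval_Comp3[OF _ _ _ eval_if_zero_prog[of p "n mod 2" "Suc 0" 0, unfolded flip]])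
      (auto intro!: eval_Proj_eq eval_Comp1 eval.Zero eval.Succ)
qed

definition half_prog :: prog where
  "half_prog =
     PrimRec Zero
       (Comp if_zero_prog [Comp parity_prog [Proj 0], Proj 1, Comp Succ [Proj 1]])"

lemma eval_half_prog: "eval p half_prog [n] (n div 2)"
  unfolding half_prog_def
proof (induction n)
  case 0
  show ?case by (auto intro: eval.intros)
next
  case (Suc n)
  have carry: "(if n mod 2 = 0 then n div 2 else Suc (n div 2)) = Suc n div 2"
    by presburger
  show ?case
    by (rule eval.PrimRec_Suc[OF Suc],
        rule eval_Comp3[OF _ _ _
          eval_if_zero_prog[of p "n mod 2" "n div 2" "Suc (n div 2)", unfolded carry]])
      (auto intro!: eval_Proj_eq eval_Comp1 eval_parity_prog eval.Succ)
qed

lemma computable_Some: "computable Some"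
  unfolding computable_def by (auto intro: eval.Query)

lemma computable_pfst: "computable (\<lambda>r. Some (pfst r))"
  unfolding computable_def pfst_def
  by (auto intro!: exI[of _ "Comp Query [double_prog]"] eval_Comp1 eval_double_prog eval.Query)

lemma computable_psnd: "computable (\<lambda>r. Some (psnd r))"
proof -
  have "eval r (Comp Query [Comp Succ [double_prog]]) [n] (r (Suc (2 * n)))" for r n
    by (rule eval_Comp1[OF _ eval.Query])+ (rule eval_Comp1[OF eval_double_prog eval.Succ])
  then show ?thesis
    unfolding computable_def psnd_def by auto
qed

definition fork :: "(baire \<rightharpoonup> baire) \<Rightarrow> (baire \<rightharpoonup> baire) \<Rightarrow> (baire \<rightharpoonup> baire)" where
  "fork A B p = (case A p of None \<Rightarrow> None | Some a \<Rightarrow> map_option (pair a) (B p))"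

lemma fork_eq_Some_iff:
  "fork A B p = Some r \<longleftrightarrow> (\<exists>a b. A p = Some a \<and> B p = Some b \<and> r = pair a b)"
  by (auto simp: fork_def split: option.splits)

text \<open>
  The program for a pair evaluates both branches at \<open>n div 2\<close> before it selects one by the
  parity of \<open>n\<close>. This is harmless, since both components are total sequences.
\<close>

lemma computable_fork:
  assumes "computable A" and "computable B"
  shows "computable (fork A B)"
proof -
  obtain c where c: "\<And>p a n. A p = Some a \<Longrightarrow> eval p c [n] (a n)"
    using assms(1) unfolding computable_def by blast
  obtain d where d: "\<And>p b n. B p = Some b \<Longrightarrow> eval p d [n] (b n)"
    using assms(2) unfolding computable_def by blast
  let ?e = "Comp if_zero_prog [parity_prog, Comp c [half_prog], Comp d [half_prog]]"
  have "eval p ?e [n] (r n)" if "fork A B p = Some r" for p r n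
  proof -
    obtain a b where ab: "A p = Some a" "B p = Some b" and r: "r = pair a b"
      using \<open>fork A B p = Some r\<close> by (auto simp: fork_eq_Some_iff)
    have "eval p ?e [n] (if n mod 2 = 0 then a (n div 2) else b (n div 2))"
      by (rule eval_Comp3[OF eval_parity_prog _ _ eval_if_zero_prog])
        (rule eval_Comp1[OF eval_half_prog], rule c d, rule ab)+
    then show ?thesis
      by (simp add: r pair_def even_iff_mod_2_eq_zero)
  qed
  then show ?thesis
    unfolding computable_def by blast
qed

section \<open>Realizers of products with the identity\<close>

lemma realizer_mid_mprod_iff:
  "realizer F (mid \<times>\<^sub>m f) \<longleftrightarrow>
     (\<forall>s p x. rep (src f) p = Some x \<and> x \<in> mdom f \<longrightarrow>
        (\<exists>q y. F (pair s p) = Some (pair s q) \<and> rep (tgt f) q = Some y \<and> y \<in> vals f x))"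
    (is "?lhs \<longleftrightarrow> ?rhs")
proof
  assume F: ?lhs
  show ?rhs
  proof (intro allI impI)
    fix s p x
    assume "rep (src f) p = Some x \<and> x \<in> mdom f"
    then have "rep (src (mid \<times>\<^sub>m f)) (pair s p) = Some (s, x) \<and> (s, x) \<in> mdom (mid \<times>\<^sub>m f)"
      by (simp add: mprod_def rep_prod_space_pair mid_def baire_space_def mdom_def)
    then obtain w z where w: "F (pair s p) = Some w" "rep (tgt (mid \<times>\<^sub>m f)) w = Some z"
        "z \<in> vals (mid \<times>\<^sub>m f) (s, x)"
      using F unfolding realizer_def by blast
    obtain v y where z: "z = (v, y)"
      by (cases z)
    have "rep (prod_space (src mid) (tgt f)) (pair (pfst w) (psnd w)) = Some (v, y)"
      using w(2) by (simp add: mprod_def mid_def z)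
    then have "pfst w = v" "rep (tgt f) (psnd w) = Some y"
      unfolding rep_prod_space_pair by (simp_all add: mid_def baire_space_def)
    moreover have "v = s" "y \<in> vals f x"
      using w(3) by (simp_all add: mprod_def mid_def z)
    ultimately show "\<exists>q y. F (pair s p) = Some (pair s q) \<and> rep (tgt f) q = Some y \<and> y \<in> vals f x"
      using w(1) pair_pfst_psnd[of w] by metis
  qed
next
  assume F: ?rhs
  show ?lhs
    unfolding realizer_def
  proof (intro allI impI)
    fix r z
    assume r: "rep (src (mid \<times>\<^sub>m f)) r = Some z \<and> z \<in> mdom (mid \<times>\<^sub>m f)"
    obtain s x where z: "z = (s, x)"
      by (cases z)
    have "rep (prod_space (src mid) (src f)) (pair (pfst r) (psnd r)) = Some (s, x)"
      using r by (simp add: mprod_def z)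
    then have s: "pfst r = s" and x: "rep (src f) (psnd r) = Some x"
      unfolding rep_prod_space_pair by (simp_all add: mid_def baire_space_def)
    have "x \<in> mdom f"
      using r by (simp add: z mdom_mprod)
    then obtain q y where q: "F (pair s (psnd r)) = Some (pair s q)" "rep (tgt f) q = Some y"
        "y \<in> vals f x"
      using F x by blast
    have "rep (tgt (mid \<times>\<^sub>m f)) (pair s q) = Some (s, y)"
      using q by (simp add: mprod_def mid_def baire_space_def rep_prod_space_pair)
    moreover have "(s, y) \<in> vals (mid \<times>\<^sub>m f) z"
      using q by (simp add: mprod_def mid_def z)
    moreover have "F r = Some (pair s q)"
      using q(1) s pair_pfst_psnd[of r] by simp
    ultimately show "\<exists>q y. F r = Some q \<and> rep (tgt (mid \<times>\<^sub>m f)) q = Some y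
        \<and> y \<in> vals (mid \<times>\<^sub>m f) z"
      by blast
  qed
qed

text \<open>
  Fixing the first argument of a realizer of \<open>id \<times> g\<close> yields a realizer of \<open>g\<close>. It is cut
  down to names of points in the domain of \<open>g\<close>, so that a reduction that succeeds with it
  is known to query it only at such names.
\<close>

lemma realizer_section:
  assumes "realizer G (mid \<times>\<^sub>m g)"
  shows "realizer (\<lambda>t. if \<exists>u\<in>mdom g. rep (src g) t = Some u
                       then map_option psnd (G (pair s t)) else None) g"
  unfolding realizer_def
proof (intro allI impI)
  fix t u
  assume t: "rep (src g) t = Some u \<and> u \<in> mdom g"
  then obtain q v where "G (pair s t) = Some (pair s q)" "rep (tgt g) q = Some v" "v \<in> vals g u"
    using assms unfolding realizer_mid_mprod_iff by blast
  then show "\<exists>q v. (if \<exists>u\<in>mdom g. rep (src g) t = Some u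
                    then map_option psnd (G (pair s t)) else None) = Some q
      \<and> rep (tgt g) q = Some v \<and> v \<in> vals g u"
    using t by auto
qed

lemma realizer_mid_mprod:
  assumes "realizer G g"
  shows "realizer (\<lambda>r. map_option (pair (pfst r)) (G (psnd r))) (mid \<times>\<^sub>m g)"
  unfolding realizer_mid_mprod_iff
proof (intro allI impI)
  fix s p x
  assume "rep (src g) p = Some x \<and> x \<in> mdom g"
  then obtain q y where "G p = Some q" "rep (tgt g) q = Some y" "y \<in> vals g x"
    using assms unfolding realizer_def by blast
  then show "\<exists>q y. map_option (pair (pfst (pair s p))) (G (psnd (pair s p))) = Some (pair s q)
      \<and> rep (tgt g) q = Some y \<and> y \<in> vals g x"
    by auto
qed

section \<open>The two reductions\<close>

lemma strong_weihrauch_le_mid_mprod_if_weihrauch_le: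
  assumes "f \<le>\<^sub>W g"
  shows "mid \<times>\<^sub>m f \<le>\<^sub>s\<^sub>W mid \<times>\<^sub>m g"
proof -
  obtain H K where HK: "computable H" "computable K"
    and red: "\<And>G. realizer G g \<Longrightarrow>
      realizer (\<lambda>p. case (G \<circ>\<^sub>m K) p of None \<Rightarrow> None | Some q \<Rightarrow> H (pair p q)) f"
    using assms unfolding weihrauch_le_def by blast
  let ?fst = "\<lambda>r. Some (pfst r)" and ?snd = "\<lambda>r. Some (psnd r)"
  define K' where "K' = fork Some (K \<circ>\<^sub>m ?snd)"
  define H' where "H' = fork (?fst \<circ>\<^sub>m ?fst) (H \<circ>\<^sub>m fork (?snd \<circ>\<^sub>m ?fst) ?snd)"
  have "computable K'" "computable H'"
    unfolding K'_def H'_def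
    by (intro computable_fork computable_map_comp computable_Some computable_pfst
        computable_psnd HK)+
  moreover have "realizer (H' \<circ>\<^sub>m G \<circ>\<^sub>m K') (mid \<times>\<^sub>m f)" if G: "realizer G (mid \<times>\<^sub>m g)" for G
    unfolding realizer_mid_mprod_iff
  proof (intro allI impI)
    fix s p x
    assume x: "rep (src f) p = Some x \<and> x \<in> mdom f"
    define r where "r = pair s p"
    define G' where "G' = (\<lambda>t. if \<exists>u\<in>mdom g. rep (src g) t = Some u
                               then map_option psnd (G (pair r t)) else None)"
    have "realizer G' g"
      unfolding G'_def by (rule realizer_section[OF G])
    from red[OF this] x obtain w y where
        w: "(case (G' \<circ>\<^sub>m K) p of None \<Rightarrow> None | Some q \<Rightarrow> H (pair p q)) = Some w"
        and y: "rep (tgt f) w = Some y" "y \<in> vals f x"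
      unfolding realizer_def by blast
    then obtain t q where t: "K p = Some t" "G' t = Some q" and Hw: "H (pair p q) = Some w"
      by (auto simp: map_comp_def split: option.splits)
    \<comment> \<open>As \<open>G'\<close> is defined at \<open>t\<close>, the realizer \<open>G\<close> has to return \<open>r\<close> there.\<close>
    obtain u where "rep (src g) t = Some u" "u \<in> mdom g"
      using t(2) by (auto simp: G'_def split: if_splits)
    moreover from this obtain q' where "G (pair r t) = Some (pair r q')"
      using G unfolding realizer_mid_mprod_iff by blast
    ultimately have "G (pair r t) = Some (pair r q)"
      using t(2) by (auto simp: G'_def split: if_splits)
    moreover have "K' (pair s p) = Some (pair r t)"
      by (simp add: K'_def fork_def t(1) r_def)
    moreover have "H' (pair r q) = Some (pair s w)"
      by (simp add: H'_def fork_def r_def Hw)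
    ultimately show "\<exists>q y. (H' \<circ>\<^sub>m G \<circ>\<^sub>m K') (pair s p) = Some (pair s q)
        \<and> rep (tgt f) q = Some y \<and> y \<in> vals f x"
      using y by (auto simp: map_comp_def)
  qed
  ultimately show ?thesis
    unfolding strong_weihrauch_le_def by blast
qed

lemma weihrauch_le_if_strong_weihrauch_le_mid_mprod:
  assumes "mid \<times>\<^sub>m f \<le>\<^sub>s\<^sub>W mid \<times>\<^sub>m g"
  shows "f \<le>\<^sub>W g"
proof -
  obtain H K where HK: "computable H" "computable K"
    and red: "\<And>G. realizer G (mid \<times>\<^sub>m g) \<Longrightarrow> realizer (H \<circ>\<^sub>m G \<circ>\<^sub>m K) (mid \<times>\<^sub>m f)"
    using assms unfolding strong_weihrauch_le_def by blast
  let ?fst = "\<lambda>r. Some (pfst r)" and ?snd = "\<lambda>r. Some (psnd r)"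
  define K' where "K' = ?snd \<circ>\<^sub>m K \<circ>\<^sub>m fork Some Some"
  define H' where "H' = ?snd \<circ>\<^sub>m H \<circ>\<^sub>m fork (?fst \<circ>\<^sub>m K \<circ>\<^sub>m fork ?fst ?fst) ?snd"
  have "computable K'" "computable H'"
    unfolding K'_def H'_def
    by (intro computable_fork computable_map_comp computable_Some computable_pfst
        computable_psnd HK)+
  moreover have "realizer (\<lambda>p. case (G \<circ>\<^sub>m K') p of None \<Rightarrow> None | Some q \<Rightarrow> H' (pair p q)) f"
    if G: "realizer G g" for G
    unfolding realizer_def
  proof (intro allI impI)
    fix p x
    assume x: "rep (src f) p = Some x \<and> x \<in> mdom f"
    obtain w y where
        w: "(H \<circ>\<^sub>m (\<lambda>r. map_option (pair (pfst r)) (G (psnd r))) \<circ>\<^sub>m K) (pair p p)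
              = Some (pair p w)"
        and y: "rep (tgt f) w = Some y" "y \<in> vals f x"
      using red[OF realizer_mid_mprod[OF G]] x unfolding realizer_mid_mprod_iff by blast
    then obtain r q where r: "K (pair p p) = Some r" "G (psnd r) = Some q"
        "H (pair (pfst r) q) = Some (pair p w)"
      by (auto simp: map_comp_Some_iff)
    then have "(G \<circ>\<^sub>m K') p = Some q" "H' (pair p q) = Some w"
      by (simp_all add: K'_def H'_def fork_def map_comp_def)
    then show "\<exists>q y. (case (G \<circ>\<^sub>m K') p of None \<Rightarrow> None | Some q \<Rightarrow> H' (pair p q)) = Some q
        \<and> rep (tgt f) q = Some y \<and> y \<in> vals f x"
      using y by simp
  qed
  ultimately show ?thesis
    unfolding weihrauch_le_def by blast
qed

theorem proposition3p5:
  fixes f :: "('a, 'b) multifun" and g :: "('c, 'd) multifun"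
  assumes "multivalued f" and "multivalued g"
  shows "f \<le>\<^sub>W g \<longleftrightarrow> mid \<times>\<^sub>m f \<le>\<^sub>s\<^sub>W mid \<times>\<^sub>m g"
  using strong_weihrauch_le_mid_mprod_if_weihrauch_le
    weihrauch_le_if_strong_weihrauch_le_mid_mprod by blast

end
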